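(* If $0\le r<t$ are integers, $m$ is a positive integer with $\gcd(m,t)=1$, and $\zeta$ is a primitive $m$th root of unity, then $$\lim_{q\to\zeta}F_{\mathcal{S}_{r,t}}(q)=\frac1t,$$ where the limit is understood as $q$ tends to $\zeta$ from within the unit disk.
   Context: $\mathcal{S}_{r,t}=\{n\in\mathbb{Z}^{+}: n\equiv r\pmod t\}$. A partition is a finite non-increasing sequence of positive integers $\lambda=(\lambda_1,\dots,\lambda_{\ell(\lambda)})$; $\mathcal{P}$ is the set of all partitions, $\ell(\lambda)$ is the number of parts, $|\lambda|=\lambda_1+\cdots+\lambda_{\ell(\lambda)}$ is the size, and $\mathrm{sm}(\lambda)=\lambda_{\ell(\lambda)}$ is the smallest part (defined for nonempty $\lambda$). The partition-theoretic Möbius function is $\mu_{\mathcal{P}}(\lambda)=0$ if $\lambda$ has repeated parts and $\mu_{\mathcal{P}}(\lambda)=(-1)^{\ell(\lambda)}$ otherwise; put $\mu^*_{\mathcal{P}}(\lambda)=-\mu_{\mathcal{P}}(\lambda)$. For a set $\mathcal{S}$ of positive integers and $|q|<1$, define $$F_{\mathcal{S}}(q)=\sum_{\lambda\in\mathcal{P},\ \mathrm{sm}(\lambda)\in\mathcal{S}}\mu^*_{\mathcal{P}}(\lambda)q^{|\lambda|},$$ the sum running over nonempty partitions whose smallest part lies in $\mathcal{S}$.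
   Formalization: The limit is taken radially, q = ρζ with ρ → 1 from below, not along arbitrary approach within the unit disk: unrestricted, the claim fails, e.g. for t = 1 one has F = 1 − ∏(1 − q^n), which is unbounded in the disk near every point of the unit circle. *)

theory Defs
  imports "HOL-Analysis.Analysis" "HOL-Number_Theory.Cong"
begin

definition partitions :: "nat list set" where
  "partitions = {l. sorted_wrt (\<ge>) l \<and> (\<forall>x\<in>set l. 0 < x)}"

definition mu_P :: "nat list \<Rightarrow> int" where
  "mu_P l = (if distinct l then (-1) ^ length l else 0)"

definition mu_P_star :: "nat list \<Rightarrow> int" where
  "mu_P_star l = - mu_P l"

definition sm :: "nat list \<Rightarrow> nat" where
  "sm l = last l"

definition residue_class :: "nat \<Rightarrow> nat \<Rightarrow> nat set" where
  "residue_class r t = {n. 0 < n \<and> [n = r] (mod t)}"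

text \<open>
  For \<open>norm q < 1\<close> the family below is absolutely summable, being dominated termwise by the
  expansion of \<open>\<Prod>n\<ge>1. 1 + norm q ^ n\<close>, so no order of summation needs to be fixed.
\<close>
definition F :: "nat set \<Rightarrow> complex \<Rightarrow> complex" where
  "F S q = (\<Sum>\<^sub>\<infinity>l\<in>{l \<in> partitions. l \<noteq> [] \<and> sm l \<in> S}. of_int (mu_P_star l) * q ^ sum_list l)"

definition primitive_root_of_unity :: "nat \<Rightarrow> complex \<Rightarrow> bool" where
  "primitive_root_of_unity m \<zeta> \<longleftrightarrow> 0 < m \<and> \<zeta> ^ m = 1 \<and> (\<forall>k. 0 < k \<and> k < m \<longrightarrow> \<zeta> ^ k \<noteq> 1)"

text \<open>
  The filter of radial approach to \<open>\<zeta>\<close> from inside the unit disk (for \<open>norm \<zeta> = 1\<close>):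
  \<open>q = \<rho> \<zeta>\<close> with \<open>\<rho>\<close> real and increasing to 1. Unrestricted approach cannot be meant: for
  \<open>t = 1\<close>, \<open>r = 0\<close> one has \<open>F S q = 1 - (\<Prod>n\<ge>1. 1 - q ^ n)\<close>, which is unbounded in the unit disk
  near every point of the unit circle.
\<close>
definition radially :: "complex \<Rightarrow> complex filter" where
  "radially \<zeta> = filtermap (\<lambda>\<rho>. complex_of_real \<rho> * \<zeta>) (at_left 1)"

end

theory Submission
  imports Defs "HOL-Real_Asymp.Real_Asymp"
begin

text \<open>
  Sorting the partitions by their smallest part \<open>n\<close> gives
  \[ F_S(q) = \sum_{n \in S} q^n \prod_{k > n} (1 - q^k)
            = (q;q)_\infty \sum_{n \in S} \frac{q^n}{(q;q)_n}. \]
  For the residue class of \<open>r\<close> modulo \<open>t\<close>, a root of unity filter and Euler's identity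
  \<open>\<Sum>n. x ^ n / (q; q)\<^sub>n = 1 / (x; q)\<^sub>\<infinity>\<close> turn this into
  \[ F_S(q) = \frac{1}{t} \sum_{j < t} \omega^{-jr}
     \Bigl( \frac{(q;q)_\infty}{(\omega^j q;q)_\infty} - (q;q)_\infty \Bigr),
     \qquad \omega = e^{2 \pi i / t}, \]
  which is \<open>F_residue_class_eq\<close>. The quotient for \<open>j = 0\<close> is identically \<open>1\<close> and
  accounts for the limit \<open>1 / t\<close>; everything else tends to \<open>0\<close> along the radius.
  
  Indeed, let \<open>norm w \<le> 1\<close> and \<open>w ^ m \<noteq> 1\<close>, where \<open>\<zeta> ^ m = 1\<close>. With
  \<open>q = \<rho> \<zeta>\<close>, the logarithm of \<open>(q; q)\<^sub>\<infinity> / (w q; q)\<^sub>\<infinity>\<close> is minus the sum over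
  \<open>n \<ge> 1\<close> of \<open>(1 - w ^ n) / n\<close> times \<open>q ^ n / (1 - q ^ n)\<close>. The terms
  with \<open>\<zeta> ^ n \<noteq> 1\<close> have bounded denominators \<open>1 - q ^ n\<close> and contribute
  \<open>O(- ln (1 - \<rho>))\<close>; those with \<open>\<zeta> ^ n = 1\<close> have nonpositive real part, and the one for
  \<open>n = m\<close> alone behaves like \<open>- c / (1 - \<rho>)\<close> with \<open>c > 0\<close>. Hence the quotient decays
  exponentially (\<open>norm_q_poch_quotient_le\<close> and \<open>q_poch_ratio_radially_tendsto_0\<close>). This
  applies to \<open>w = 0\<close>, and to \<open>w = \<omega> ^ j\<close> with \<open>0 < j < t\<close> because \<open>m\<close> is coprime to
  \<open>t\<close>.
\<close>

section \<open>Summation over partitions into distinct parts\<close>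

definition strict_partitions_upto :: "nat \<Rightarrow> nat list set" where
  "strict_partitions_upto N = {l. sorted_wrt (>) l \<and> set l \<subseteq> {1..N}}"

lemma strict_partitions_upto_0: "strict_partitions_upto 0 = {[]}"
  by (auto simp: strict_partitions_upto_def)

text \<open>
  Only partitions into distinct parts have a nonzero Moebius value. Written as decreasing lists, those
  with parts up to \<open>N + 1\<close> either avoid \<open>N + 1\<close> or have it as head, and prepending a new
  largest part to a nonempty list leaves its smallest part unchanged. All the finite sums over
  partitions below are evaluated with this recursion.
\<close>

lemma strict_partitions_upto_Suc:
  "strict_partitions_upto (Suc N) = strict_partitions_upto N \<union> (#) (Suc N) ` strict_partitions_upto N"
proof (intro equalityI subsetI)
  fix l assume l: "l \<in> strict_partitions_upto (Suc N)"
  show "l \<in> strict_partitions_upto N \<union> (#) (Suc N) ` strict_partitions_upto N"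
  proof (cases l)
    case Nil
    then show ?thesis by (simp add: strict_partitions_upto_def)
  next
    case (Cons a l')
    have 1: "sorted_wrt (>) l'" "\<And>x. x \<in> set l' \<Longrightarrow> x < a \<and> 1 \<le> x" "1 \<le> a" "a \<le> Suc N"
      using l Cons by (auto simp: strict_partitions_upto_def)
    show ?thesis
    proof (cases "a = Suc N")
      case True
      then have "l' \<in> strict_partitions_upto N"
        using 1 by (force simp: strict_partitions_upto_def)
      then show ?thesis using Cons True by auto
    next
      case False
      then have "l \<in> strict_partitions_upto N"
        using 1 Cons by (force simp: strict_partitions_upto_def)
      then show ?thesis by auto
    qed
  qed
next
  fix l assume "l \<in> strict_partitions_upto N \<union> (#) (Suc N) ` strict_partitions_upto N"
  then show "l \<in> strict_partitions_upto (Suc N)"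
    by (force simp: strict_partitions_upto_def)
qed

lemma strict_partitions_upto_mono: "M \<le> N \<Longrightarrow> strict_partitions_upto M \<subseteq> strict_partitions_upto N"
  by (force simp: strict_partitions_upto_def)

lemma finite_strict_partitions_upto: "finite (strict_partitions_upto N)"
  by (induction N) (auto simp: strict_partitions_upto_0 strict_partitions_upto_Suc)

lemma sum_strict_partitions_upto_Suc:
  fixes f :: "nat list \<Rightarrow> 'a :: comm_monoid_add"
  shows "(\<Sum>l\<in>strict_partitions_upto (Suc N). f l) =
    (\<Sum>l\<in>strict_partitions_upto N. f l) + (\<Sum>l\<in>strict_partitions_upto N. f (Suc N # l))"
proof -
  have "strict_partitions_upto N \<inter> (#) (Suc N) ` strict_partitions_upto N = {}"
    by (auto simp: strict_partitions_upto_def)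
  then show ?thesis
    unfolding strict_partitions_upto_Suc
    by (subst sum.union_disjoint) (auto simp: finite_strict_partitions_upto sum.reindex)
qed

lemma sum_power_strict_partitions_upto:
  fixes x :: "'a :: comm_semiring_1"
  shows "(\<Sum>l\<in>strict_partitions_upto N. x ^ sum_list l) = (\<Prod>k=1..N. 1 + x ^ k)"
proof (induction N)
  case (Suc N)
  then show ?case
    by (simp add: sum_strict_partitions_upto_Suc power_add flip: sum_distrib_left)
       (simp add: algebra_simps)
qed (simp add: strict_partitions_upto_0)

text \<open>
  The part of the series \<open>F S q\<close> that comes from partitions into parts of size at most \<open>N\<close>,
  sorted by the smallest part \<open>n\<close>: the remaining parts form an arbitrary subset of the numbers
  from \<open>n + 1\<close> to \<open>N\<close>.
\<close>

definition smallest_part_poly :: "nat set \<Rightarrow> complex \<Rightarrow> nat \<Rightarrow> complex" where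
  "smallest_part_poly S q N = (\<Sum>n\<in>{1..N} \<inter> S. q ^ n * (\<Prod>k\<in>{n<..N}. 1 - q ^ k))"

lemma smallest_part_poly_Suc:
  "smallest_part_poly S q (Suc N) =
     smallest_part_poly S q N * (1 - q ^ Suc N) + (if Suc N \<in> S then q ^ Suc N else 0)"
proof -
  have "(\<Sum>n\<in>{1..N} \<inter> S. q ^ n * (\<Prod>k\<in>{n<..Suc N}. 1 - q ^ k)) =
        (\<Sum>n\<in>{1..N} \<inter> S. q ^ n * (\<Prod>k\<in>{n<..N}. 1 - q ^ k)) * (1 - q ^ Suc N)"
  proof (subst sum_distrib_right, rule sum.cong)
    fix n assume "n \<in> {1..N} \<inter> S"
    then have "{n<..Suc N} = insert (Suc N) {n<..N}" by auto
    then show "q ^ n * (\<Prod>k\<in>{n<..Suc N}. 1 - q ^ k) =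
        q ^ n * (\<Prod>k\<in>{n<..N}. 1 - q ^ k) * (1 - q ^ Suc N)"
      by simp
  qed simp
  moreover have "{1..Suc N} \<inter> S = (if Suc N \<in> S then insert (Suc N) ({1..N} \<inter> S) else {1..N} \<inter> S)"
    by (auto simp: le_Suc_eq)
  ultimately show ?thesis
    by (simp add: smallest_part_poly_def)
qed

text \<open>
  Prepending \<open>N + 1\<close> to a nonempty partition multiplies its term by \<open>- q ^ (N + 1)\<close>,
  which produces the factor \<open>1 - q ^ (N + 1)\<close>; prepending it to the empty one creates the new
  partition whose smallest part is \<open>N + 1\<close>. This is the recursion of
  \<open>smallest_part_poly\<close> in \<open>N\<close>.
\<close>

lemma sum_strict_partitions_upto_smallest_part:
  "(\<Sum>l\<in>strict_partitions_upto N. if l \<noteq> [] \<and> last l \<in> S then - ((-1) ^ length l * q ^ sum_list l) else 0)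
   = smallest_part_poly S q N" (is "sum ?f _ = _")
proof (induction N)
  case 0
  then show ?case by (simp add: strict_partitions_upto_0 smallest_part_poly_def)
next
  case (Suc N)
  let ?X = "strict_partitions_upto N"
  have nil: "[] \<in> ?X" by (simp add: strict_partitions_upto_def)
  have "(\<Sum>l\<in>?X. ?f (Suc N # l)) =
      ?f [Suc N] + (\<Sum>l\<in>?X - {[]}. ?f (Suc N # l))"
    using nil finite_strict_partitions_upto by (subst sum.remove[of _ "[]"]) auto
  also have "(\<Sum>l\<in>?X - {[]}. ?f (Suc N # l)) = (\<Sum>l\<in>?X - {[]}. - (q ^ Suc N) * ?f l)"
    by (rule sum.cong) (auto simp: power_add)
  also have "\<dots> = (\<Sum>l\<in>?X. - (q ^ Suc N) * ?f l)"
    using nil finite_strict_partitions_upto by (subst (2) sum.remove[of _ "[]"]) auto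
  also have "\<dots> = - (q ^ Suc N) * smallest_part_poly S q N"
    by (simp only: Suc.IH flip: sum_distrib_left)
  finally show ?case
    by (simp add: sum_strict_partitions_upto_Suc Suc.IH smallest_part_poly_Suc algebra_simps)
qed

lemma prod_one_plus_power_le:
  fixes x :: real
  assumes "0 \<le> x" "x < 1"
  shows "(\<Prod>k=1..N. 1 + x ^ k) \<le> exp (1 / (1 - x))"
proof -
  have "(\<Prod>k=1..N. 1 + x ^ k) \<le> (\<Prod>k=1..N. exp (x ^ k))"
    using assms by (intro prod_mono) (auto intro!: add_nonneg_nonneg)
  also have "\<dots> = exp (\<Sum>k=1..N. x ^ k)" by (simp add: exp_sum)
  also have "(\<Sum>k=1..N. x ^ k) \<le> (\<Sum>k. x ^ k)"
    using assms by (intro sum_le_suminf) auto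
  also have "\<dots> = 1 / (1 - x)" using assms by (intro suminf_geometric) auto
  finally show ?thesis by simp
qed

lemma finite_family_in_strict_partitions_upto:
  assumes "finite X" "X \<subseteq> {l. sorted_wrt (>) l \<and> 0 \<notin> set l}"
  shows "\<exists>N. X \<subseteq> strict_partitions_upto N"
proof -
  have "finite (\<Union> (set ` X))" using assms by auto
  then obtain N where "\<Union> (set ` X) \<subseteq> {..N}"
    using finite_nat_set_iff_bounded_le by (metis atMost_iff subsetI)
  then have "X \<subseteq> strict_partitions_upto N"
    using assms(2) by (force simp: strict_partitions_upto_def Suc_le_eq intro!: Nat.gr0I)
  then show ?thesis ..
qed

text \<open>
  A finite family of strict partitions has bounded parts, so its sum of \<open>norm q ^ sum_list l\<close>
  is at most \<open>\<Prod>k=1..N. 1 + norm q ^ k\<close>, which is bounded independently of \<open>N\<close>.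
\<close>

lemma summable_on_strict_partitions:
  assumes "norm (q :: complex) < 1"
  shows "(\<lambda>l. norm (q ^ sum_list l)) summable_on {l. sorted_wrt (>) l \<and> 0 \<notin> set l}"
proof (rule nonneg_bdd_above_summable_on)
  show "bdd_above (sum (\<lambda>l. norm (q ^ sum_list l)) ` {X. X \<subseteq> {l. sorted_wrt (>) l \<and> 0 \<notin> set l} \<and> finite X})"
  proof (rule bdd_aboveI2)
    fix X :: "nat list set"
    assume "X \<in> {X. X \<subseteq> {l. sorted_wrt (>) l \<and> 0 \<notin> set l} \<and> finite X}"
    then obtain N where "X \<subseteq> strict_partitions_upto N"
      using finite_family_in_strict_partitions_upto by blast
    then have "(\<Sum>l\<in>X. norm (q ^ sum_list l)) \<le> (\<Sum>l\<in>strict_partitions_upto N. norm q ^ sum_list l)"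
      unfolding norm_power by (intro sum_mono2) (auto simp: finite_strict_partitions_upto)
    also have "\<dots> \<le> exp (1 / (1 - norm q))"
      using assms by (simp only: sum_power_strict_partitions_upto prod_one_plus_power_le norm_ge_zero)
    finally show "(\<Sum>l\<in>X. norm (q ^ sum_list l)) \<le> exp (1 / (1 - norm q))" .
  qed
qed auto

lemma sorted_wrt_greater_iff:
  fixes l :: "'a :: linorder list"
  shows "sorted_wrt (>) l \<longleftrightarrow> sorted_wrt (\<ge>) l \<and> distinct l"
  using strict_sorted_iff[of "rev l"] by (simp add: sorted_wrt_rev)

text \<open>
  By absolute summability the unordered sum may be computed along the exhaustion by partitions with
  parts of size at most \<open>N\<close>.
\<close>

lemma smallest_part_poly_tendsto_F:
  assumes "norm q < 1"
  shows "smallest_part_poly S q \<longlonglongrightarrow> F S q"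
proof -
  define D :: "nat list set" where "D = {l. sorted_wrt (>) l \<and> 0 \<notin> set l}"
  define f where "f = (\<lambda>l. if l \<noteq> [] \<and> last l \<in> S then - ((-1) ^ length l * q ^ sum_list l) else 0)"
  have sub: "strict_partitions_upto N \<subseteq> D" for N
    by (auto simp: strict_partitions_upto_def D_def)
  have "(\<lambda>l. norm (f l)) summable_on D"
    using summable_on_strict_partitions[OF assms] unfolding D_def
    by (rule Infinite_Sum.abs_summable_on_comparison_test) (simp add: f_def norm_mult norm_power)
  then have "f summable_on D" by (rule abs_summable_summable)
  then have "(sum f \<longlongrightarrow> infsum f D) (finite_subsets_at_top D)"
    using has_sum_infsum has_sum_def by blast
  moreover have "filterlim strict_partitions_upto (finite_subsets_at_top D) sequentially"
    unfolding filterlim_finite_subsets_at_top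
  proof (intro allI impI)
    fix X assume "finite X \<and> X \<subseteq> D"
    then obtain M where "X \<subseteq> strict_partitions_upto M"
      using finite_family_in_strict_partitions_upto unfolding D_def by blast
    then show "\<forall>\<^sub>F N in sequentially. finite (strict_partitions_upto N) \<and>
        X \<subseteq> strict_partitions_upto N \<and> strict_partitions_upto N \<subseteq> D"
      using strict_partitions_upto_mono sub finite_strict_partitions_upto
      by (intro eventually_sequentiallyI[of M]) blast
  qed
  ultimately have "(\<lambda>N. sum f (strict_partitions_upto N)) \<longlonglongrightarrow> infsum f D"
    by (rule filterlim_compose)
  moreover have "infsum f D = F S q"
    unfolding F_def
  proof (rule infsum_cong_neutral)
    fix l assume "l \<in> {l \<in> partitions. l \<noteq> [] \<and> sm l \<in> S} - D"
    then have "\<not> distinct l"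
      by (auto simp: D_def partitions_def sorted_wrt_greater_iff)
    then show "of_int (mu_P_star l) * q ^ sum_list l = 0"
      by (simp add: mu_P_star_def mu_P_def)
  next
    fix l assume "l \<in> D - {l \<in> partitions. l \<noteq> [] \<and> sm l \<in> S}"
    then show "f l = 0"
      by (auto simp: D_def partitions_def f_def sm_def sorted_wrt_greater_iff intro!: Nat.gr0I)
  next
    fix l assume "l \<in> D \<inter> {l \<in> partitions. l \<noteq> [] \<and> sm l \<in> S}"
    then show "f l = of_int (mu_P_star l) * q ^ sum_list l"
      by (auto simp: D_def f_def sm_def mu_P_star_def mu_P_def sorted_wrt_greater_iff)
  qed
  ultimately show ?thesis
    by (simp add: f_def sum_strict_partitions_upto_smallest_part)
qed

section \<open>Quotients of q-Pochhammer symbols and Euler's series\<close>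

text \<open>
  In the usual notation this is \<open>(wq; q)\<^sub>N\<close>; the product starts at \<open>k = 1\<close>, so that
  \<open>w = 1\<close> gives \<open>(q; q)\<^sub>N\<close> and, for \<open>norm q < 1\<close>, all factors are nonzero on the
  closed disk \<open>norm w \<le> 1\<close>.
\<close>

definition q_poch :: "complex \<Rightarrow> complex \<Rightarrow> nat \<Rightarrow> complex" where
  "q_poch w q N = (\<Prod>k=1..N. 1 - w * q ^ k)"

lemma q_poch_0 [simp]: "q_poch w q 0 = 1"
  by (simp add: q_poch_def)

lemma q_poch_Suc: "q_poch w q (Suc N) = q_poch w q N * (1 - w * q ^ Suc N)"
  by (simp add: q_poch_def)

lemma q_poch_zero [simp]: "q_poch 0 q N = 1"
  by (simp add: q_poch_def)

lemma norm_mult_power_less_one: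
  fixes w q :: complex
  assumes "norm w \<le> 1" "norm q < 1" "0 < k"
  shows "norm (w * q ^ k) < 1"
proof -
  have "norm (w * q ^ k) \<le> 1 * norm q ^ k"
    unfolding norm_mult norm_power using assms by (intro mult_right_mono) auto
  also have "\<dots> < 1"
    using assms power_less_one_iff[of "norm q" k] by simp
  finally show ?thesis .
qed

lemma q_poch_factor_nonzero:
  fixes w q :: complex
  assumes "norm w \<le> 1" "norm q < 1" "0 < k"
  shows "1 - w * q ^ k \<noteq> 0"
  using norm_mult_power_less_one[OF assms] by auto

lemma q_poch_nonzero:
  assumes "norm w \<le> 1" "norm q < 1"
  shows "q_poch w q N \<noteq> 0"
  using q_poch_factor_nonzero[OF assms] by (auto simp: q_poch_def)

lemma q_poch_tendsto_nonzero:
  assumes "norm w \<le> 1" "norm q < 1"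
  obtains L where "L \<noteq> 0" "q_poch w q \<longlonglongrightarrow> L"
proof -
  let ?f = "\<lambda>k. 1 - w * q ^ Suc k"
  have "summable (\<lambda>k. norm w * norm q * norm q ^ k)"
    using assms(2) by (intro summable_mult summable_geometric) auto
  then have "abs_convergent_prod ?f"
    by (simp add: abs_convergent_prod_conv_summable norm_mult norm_power mult_ac)
  then have conv: "convergent_prod ?f"
    by (rule abs_convergent_prod_imp_convergent_prod)
  have "(\<lambda>N. q_poch w q (Suc N)) \<longlonglongrightarrow> prodinf ?f"
    using convergent_prod_LIMSEQ[OF conv]
    by (simp only: q_poch_def One_nat_def prod.atLeast1_atMost_eq lessThan_Suc_atMost)
  then have "q_poch w q \<longlonglongrightarrow> prodinf ?f"
    by (simp only: filterlim_sequentially_Suc)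
  moreover have "prodinf ?f \<noteq> 0"
    using conv q_poch_factor_nonzero[OF assms zero_less_Suc] by (intro prodinf_nonzero)
  ultimately show ?thesis by (rule that[rotated])
qed

text \<open>
  The function \<open>(q; q)\<^sub>\<infinity> / (wq; q)\<^sub>\<infinity>\<close>. The value \<open>w = 0\<close> gives the Euler
  product \<open>(q; q)\<^sub>\<infinity>\<close> itself, so one decay estimate serves for both.
\<close>

definition q_poch_ratio :: "complex \<Rightarrow> complex \<Rightarrow> complex" where
  "q_poch_ratio w q = lim (\<lambda>N. q_poch 1 q N / q_poch w q N)"

lemma q_poch_ratio_tendsto:
  assumes "norm w \<le> 1" "norm q < 1"
  shows "(\<lambda>N. q_poch 1 q N / q_poch w q N) \<longlonglongrightarrow> q_poch_ratio w q"
proof -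
  obtain L1 where "q_poch 1 q \<longlonglongrightarrow> L1"
    using q_poch_tendsto_nonzero[of 1 q] assms by auto
  moreover obtain L where "L \<noteq> 0" "q_poch w q \<longlonglongrightarrow> L"
    using q_poch_tendsto_nonzero[OF assms] by auto
  ultimately have "convergent (\<lambda>N. q_poch 1 q N / q_poch w q N)"
    by (auto intro: convergentI tendsto_divide)
  then show ?thesis
    by (simp add: q_poch_ratio_def convergent_LIMSEQ_iff)
qed

lemma q_poch_ratio_one:
  assumes "norm q < 1"
  shows "q_poch_ratio 1 q = 1"
  using q_poch_nonzero[of 1 q] assms by (simp add: q_poch_ratio_def)

text \<open>
  The coefficients \<open>1 / (q; q)\<^sub>n\<close> converge, because the infinite product is nonzero, so they
  are bounded and a geometric series dominates.
\<close>

lemma summable_euler: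
  assumes "norm q < 1" "norm x < 1"
  shows "summable (\<lambda>n. 1 / q_poch 1 q n * x ^ n)"
proof -
  obtain L where "L \<noteq> 0" "q_poch 1 q \<longlonglongrightarrow> L"
    using q_poch_tendsto_nonzero[of 1 q] assms by auto
  then have "(\<lambda>n. 1 / q_poch 1 q n) \<longlonglongrightarrow> 1 / L"
    by (intro tendsto_divide tendsto_const)
  then have "Bseq (\<lambda>n. 1 / q_poch 1 q n)"
    by (intro convergent_imp_Bseq convergentI)
  then obtain K where "0 < K" and K: "\<forall>n. norm (1 / q_poch 1 q n) \<le> K"
    by (rule BseqE)
  have "norm (1 / q_poch 1 q n * x ^ n) \<le> K * norm x ^ n" for n
    unfolding norm_mult norm_power using K by (intro mult_right_mono) auto
  moreover have "summable (\<lambda>n. K * norm x ^ n)"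
    using assms(2) by (intro summable_mult summable_geometric) auto
  ultimately show ?thesis
    by (rule summable_comparison_test'[where N = 0, rotated])
qed

text \<open>
  The coefficients \<open>c\<^sub>n = 1 / (q; q)\<^sub>n\<close> satisfy \<open>c\<^sub>n\<^sub>+\<^sub>1 (1 - q ^ (n + 1)) = c\<^sub>n\<close>, so
  \<open>E x - E (q x)\<close> is \<open>x\<close> times the series \<open>E x\<close>, shifted by one index.
\<close>

lemma euler_functional_equation:
  assumes "norm q < 1" "norm x < 1"
  defines "E \<equiv> \<lambda>x. \<Sum>n. 1 / q_poch 1 q n * x ^ n"
  shows "(1 - x) * E x = E (q * x)"
proof -
  let ?c = "\<lambda>n. 1 / q_poch 1 q n"
  have qx: "norm (q * x) < 1"
    using norm_mult_power_less_one[of x q 1] assms(1,2) by (simp add: mult.commute)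
  have sx: "(\<lambda>n. ?c n * x ^ n) sums E x" and sqx: "(\<lambda>n. ?c n * (q * x) ^ n) sums E (q * x)"
    using summable_euler assms(1,2) qx by (auto simp: E_def summable_sums)
  have "(\<lambda>n. ?c n * x ^ n - ?c n * (q * x) ^ n) sums (E x - E (q * x))"
    by (rule sums_diff[OF sx sqx])
  then have "(\<lambda>n. ?c (Suc n) * x ^ Suc n - ?c (Suc n) * (q * x) ^ Suc n) sums (E x - E (q * x))"
    by (subst sums_Suc_iff) simp
  moreover have "?c (Suc n) * x ^ Suc n - ?c (Suc n) * (q * x) ^ Suc n = x * (?c n * x ^ n)" for n
  proof -
    have "?c (Suc n) * x ^ Suc n - ?c (Suc n) * (q * x) ^ Suc n
        = x * (x ^ n * (1 - 1 * q ^ Suc n) / q_poch 1 q (Suc n))"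
      by (simp add: power_mult_distrib diff_divide_distrib algebra_simps)
    also have "\<dots> = x * (?c n * x ^ n)"
      using q_poch_factor_nonzero[of 1 q "Suc n"] assms(1) by (simp add: q_poch_Suc)
    finally show ?thesis .
  qed
  ultimately have "(\<lambda>n. x * (?c n * x ^ n)) sums (E x - E (q * x))"
    by simp
  then have "E x - E (q * x) = x * E x"
    by (rule sums_unique2[OF _ sums_mult[OF sx]])
  then show ?thesis by (simp add: algebra_simps)
qed

text \<open>
  Euler's identity \<open>\<Sum>n. x ^ n / (q; q)\<^sub>n = 1 / (x; q)\<^sub>\<infinity>\<close> at \<open>x = w q\<close>. Iterating the
  functional equation moves the argument to \<open>w q ^ (N + 1)\<close>, which tends to \<open>0\<close>, where the
  series has the value \<open>1\<close>.
\<close>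

lemma euler_sums:
  assumes "norm w \<le> 1" "norm q < 1" "q_poch w q \<longlonglongrightarrow> L" "L \<noteq> 0"
  shows "(\<lambda>n. (w * q) ^ n / q_poch 1 q n) sums (1 / L)"
proof -
  define E where "E = (\<lambda>x. \<Sum>n. 1 / q_poch 1 q n * x ^ n)"
  have less1: "norm (w * q ^ Suc N) < 1" for N
    using norm_mult_power_less_one[OF assms(1,2)] by (simp del: power_Suc)
  have iter: "q_poch w q N * E (w * q) = E (w * q ^ Suc N)" for N
  proof (induction N)
    case (Suc N)
    have "q_poch w q (Suc N) * E (w * q) = (1 - w * q ^ Suc N) * (q_poch w q N * E (w * q))"
      by (simp only: q_poch_Suc mult_ac)
    also have "\<dots> = (1 - w * q ^ Suc N) * E (w * q ^ Suc N)"
      by (simp only: Suc.IH)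
    also have "\<dots> = E (q * (w * q ^ Suc N))"
      unfolding E_def by (rule euler_functional_equation[OF assms(2) less1])
    also have "q * (w * q ^ Suc N) = w * q ^ Suc (Suc N)"
      by simp
    finally show ?case .
  qed simp
  have "isCont E 0"
    unfolding E_def
    by (rule isCont_powser[OF summable_euler[OF assms(2), of "1/2"]]) auto
  moreover have "(\<lambda>N. w * q ^ Suc N) \<longlonglongrightarrow> 0"
    using LIMSEQ_power_zero[OF assms(2)] by (intro tendsto_mult_right_zero) (simp only: filterlim_sequentially_Suc)
  ultimately have "(\<lambda>N. E (w * q ^ Suc N)) \<longlonglongrightarrow> E 0"
    by (rule isCont_tendsto_compose)
  moreover have "E 0 = 1"
    unfolding E_def by (subst powser_zero) simp
  ultimately have "(\<lambda>N. q_poch w q N * E (w * q)) \<longlonglongrightarrow> 1"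
    by (simp only: iter)
  moreover have "(\<lambda>N. q_poch w q N * E (w * q)) \<longlonglongrightarrow> L * E (w * q)"
    by (intro tendsto_mult_right assms)
  ultimately have "L * E (w * q) = 1"
    by (rule LIMSEQ_unique[rotated])
  then have "E (w * q) = 1 / L"
    using assms(4) by (simp add: field_simps)
  then show ?thesis
    using summable_sums[OF summable_euler[OF assms(2) less1[of 0]]] by (simp add: E_def)
qed

section \<open>Selecting a residue class by roots of unity\<close>

text \<open>
  Dividing by \<open>(q; q)\<^sub>N\<close> removes the dependence of the summands on \<open>N\<close> and so turns the
  polynomials into partial sums of a series.
\<close>

lemma smallest_part_poly_eq:
  assumes "norm q < 1"
  shows "smallest_part_poly S q N = q_poch 1 q N * (\<Sum>n\<in>{1..N} \<inter> S. q ^ n / q_poch 1 q n)"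
  unfolding smallest_part_poly_def sum_distrib_left
proof (rule sum.cong)
  fix n assume n: "n \<in> {1..N} \<inter> S"
  have "{1..N} = {1..n} \<union> {n<..N}" using n by auto
  then have "q_poch 1 q N = q_poch 1 q n * (\<Prod>k\<in>{n<..N}. 1 - q ^ k)"
    unfolding q_poch_def by (simp, subst prod.union_disjoint) auto
  then show "q ^ n * (\<Prod>k\<in>{n<..N}. 1 - q ^ k) = q_poch 1 q N * (q ^ n / q_poch 1 q n)"
    using q_poch_nonzero[of 1 q n] assms by simp
qed simp

definition unity_root :: "nat \<Rightarrow> nat \<Rightarrow> complex" where
  "unity_root t j = exp (2 * of_real pi * \<i> * of_nat j / of_nat t)"

lemma norm_unity_root [simp]: "norm (unity_root t j) = 1"
  by (simp add: unity_root_def norm_exp_eq_Re)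

lemma unity_root_power: "unity_root t j ^ n = unity_root t (n * j)"
  by (simp add: unity_root_def mult_ac flip: exp_of_nat_mult)

lemma unity_root_eq_1_iff: "0 < t \<Longrightarrow> unity_root t j = 1 \<longleftrightarrow> t dvd j"
  unfolding unity_root_def by (rule complex_root_unity_eq_1) simp

text \<open>
  The sum is geometric in the ratio of the two roots of unity with indices \<open>n\<close> and \<open>r\<close>,
  whose \<open>t\<close>-th power is \<open>1\<close>.
\<close>

lemma sum_unity_root_filter:
  assumes "0 < t"
  shows "(\<Sum>j<t. unity_root t j ^ n / unity_root t j ^ r) = (if [n = r] (mod t) then of_nat t else 0)"
proof -
  define z where "z = unity_root t n / unity_root t r"
  have nz: "unity_root t k \<noteq> 0" for k
    by (simp add: unity_root_def)
  have "unity_root t j ^ n / unity_root t j ^ r = z ^ j" for j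
    by (simp add: z_def power_divide unity_root_power mult.commute)
  then have eq: "(\<Sum>j<t. unity_root t j ^ n / unity_root t j ^ r) = (\<Sum>j<t. z ^ j)"
    by simp
  have "z ^ t = 1"
    using assms by (simp add: z_def power_divide unity_root_power unity_root_eq_1_iff[THEN iffD2])
  have "z = 1 \<longleftrightarrow> [n = r] (mod t)"
    using complex_root_unity_eq[of t n r] assms nz[of r]
    by (simp add: z_def unity_root_def cong_def)
  then show ?thesis
    using \<open>z ^ t = 1\<close> sum_gp_strict[of z t] by (simp add: eq)
qed

text \<open>
  The root of unity filter splits the series over the residue class into \<open>t\<close> Euler series.
  Each lacks its constant term \<open>1\<close>, since partitions have positive parts; multiplied by
  \<open>(q; q)\<^sub>\<infinity>\<close>, these missing terms account for the subtracted \<open>q_poch_ratio 0 q\<close>.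
\<close>

lemma F_residue_class_eq:
  assumes "norm q < 1" "0 < t"
  shows "F (residue_class r t) q = (\<Sum>j<t. (q_poch_ratio (unity_root t j) q - q_poch_ratio 0 q)
            / unity_root t j ^ r) / of_nat t"
proof -
  define w where "w = unity_root t"
  have w: "norm (w j) \<le> 1" for j by (simp add: w_def)
  obtain P where P: "P \<noteq> 0" "q_poch 1 q \<longlonglongrightarrow> P"
    using q_poch_tendsto_nonzero[of 1 q] assms by auto
  have "q_poch 1 q \<longlonglongrightarrow> q_poch_ratio 0 q"
    using q_poch_ratio_tendsto[of 0 q] assms by simp
  then have "q_poch_ratio 0 q = P"
    by (rule LIMSEQ_unique[OF _ P(2)])
  have lim: "(\<lambda>N. q_poch 1 q N * (\<Sum>n=1..N. (w j * q) ^ n / q_poch 1 q n)) \<longlonglongrightarrow>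
      q_poch_ratio (w j) q - q_poch_ratio 0 q" for j
  proof -
    obtain L where L: "L \<noteq> 0" "q_poch (w j) q \<longlonglongrightarrow> L"
      using q_poch_tendsto_nonzero[OF w assms(1)] by blast
    have "q_poch_ratio (w j) q = P / L"
      by (rule LIMSEQ_unique[OF q_poch_ratio_tendsto[OF w assms(1)] tendsto_divide[OF P(2) L(2,1)]])
    moreover have "(\<lambda>N. \<Sum>n\<le>N. (w j * q) ^ n / q_poch 1 q n) \<longlonglongrightarrow> 1 / L"
      using euler_sums[OF w assms(1) L(2,1)] by (simp add: sums_def_le)
    then have "(\<lambda>N. q_poch 1 q N * ((\<Sum>n\<le>N. (w j * q) ^ n / q_poch 1 q n) - 1)) \<longlonglongrightarrow> P * (1 / L - 1)"
      by (intro tendsto_intros P)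
    moreover have "(\<Sum>n\<le>N. (w j * q) ^ n / q_poch 1 q n) - 1 = (\<Sum>n=1..N. (w j * q) ^ n / q_poch 1 q n)" for N
      by (simp add: sum.atMost_shift sum.atLeast1_atMost_eq)
    ultimately show ?thesis
      using \<open>q_poch_ratio 0 q = P\<close> by (simp add: algebra_simps)
  qed
  have "smallest_part_poly (residue_class r t) q N =
      (\<Sum>j<t. (q_poch 1 q N * (\<Sum>n=1..N. (w j * q) ^ n / q_poch 1 q n)) / w j ^ r) / of_nat t" for N
  proof -
    have "(\<Sum>j<t. (\<Sum>n=1..N. (w j * q) ^ n / q_poch 1 q n) / w j ^ r)
        = (\<Sum>n=1..N. \<Sum>j<t. (w j * q) ^ n / q_poch 1 q n / w j ^ r)"
      unfolding sum_divide_distrib by (rule sum.swap)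
    also have "\<dots> = (\<Sum>n=1..N. q ^ n / q_poch 1 q n * (\<Sum>j<t. w j ^ n / w j ^ r))"
      by (simp add: sum_distrib_left power_mult_distrib mult_ac)
    also have "\<dots> = (\<Sum>n=1..N. if n \<in> residue_class r t then of_nat t * (q ^ n / q_poch 1 q n) else 0)"
      by (intro sum.cong) (auto simp: w_def sum_unity_root_filter[OF assms(2)] residue_class_def)
    also have "\<dots> = of_nat t * (\<Sum>n\<in>{1..N} \<inter> residue_class r t. q ^ n / q_poch 1 q n)"
      by (simp add: sum.inter_restrict sum_distrib_left if_distrib cong: if_cong)
    finally have filter: "(\<Sum>j<t. (\<Sum>n=1..N. (w j * q) ^ n / q_poch 1 q n) / w j ^ r)
        = of_nat t * (\<Sum>n\<in>{1..N} \<inter> residue_class r t. q ^ n / q_poch 1 q n)" .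
    have "(\<Sum>j<t. (q_poch 1 q N * (\<Sum>n=1..N. (w j * q) ^ n / q_poch 1 q n)) / w j ^ r)
        = q_poch 1 q N * (\<Sum>j<t. (\<Sum>n=1..N. (w j * q) ^ n / q_poch 1 q n) / w j ^ r)"
      by (simp only: sum_distrib_left times_divide_eq_right)
    then show ?thesis
      unfolding filter using assms by (simp add: smallest_part_poly_eq)
  qed
  then have "smallest_part_poly (residue_class r t) q = (\<lambda>N.
      (\<Sum>j<t. (q_poch 1 q N * (\<Sum>n=1..N. (w j * q) ^ n / q_poch 1 q n)) / w j ^ r) / of_nat t)"
    by (rule ext)
  moreover have "(\<lambda>N. (\<Sum>j<t. (q_poch 1 q N * (\<Sum>n=1..N. (w j * q) ^ n / q_poch 1 q n)) / w j ^ r) / of_nat t)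
      \<longlonglongrightarrow> (\<Sum>j<t. (q_poch_ratio (w j) q - q_poch_ratio 0 q) / w j ^ r) / of_nat t"
    using assms(2) by (intro tendsto_intros lim) (auto simp: w_def unity_root_def)
  ultimately have "smallest_part_poly (residue_class r t) q \<longlonglongrightarrow>
      (\<Sum>j<t. (q_poch_ratio (w j) q - q_poch_ratio 0 q) / w j ^ r) / of_nat t"
    by (simp only:)
  then show ?thesis
    unfolding w_def by (rule LIMSEQ_unique[OF smallest_part_poly_tendsto_F[OF assms(1)]])
qed

section \<open>Radial decay\<close>

text \<open>
  Both \<open>norm (1 - s z) \<ge> 1 - s\<close> and
  \<open>norm (1 - z) \<le> norm (1 - s z) + (1 - s)\<close> hold, so moving radially inwards from \<open>z\<close>
  at most halves the distance to \<open>1\<close>.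
\<close>

lemma norm_one_minus_scaled_ge:
  fixes z :: complex
  assumes "norm z = 1" "0 \<le> s" "s \<le> 1"
  shows "norm (1 - z) / 2 \<le> norm (1 - of_real s * z)"
proof -
  have "norm (1 - z) \<le> norm (1 - of_real s * z) + norm (of_real (s - 1) * z)"
    using norm_triangle_ineq[of "1 - of_real s * z" "of_real (s - 1) * z"] by (simp add: algebra_simps)
  moreover have "norm (of_real (s - 1) * z) = 1 - s"
    using assms by (simp add: norm_mult del: of_real_diff)
  moreover have "1 - s \<le> norm (1 - of_real s * z)"
    using norm_triangle_ineq2[of 1 "of_real s * z"] assms by (simp add: norm_mult)
  ultimately show ?thesis by simp
qed

lemma root_of_unity_powers_gap:
  fixes \<zeta> :: complex
  assumes "0 < m" "\<zeta> ^ m = 1"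
  obtains \<delta> where "0 < \<delta>" "\<And>n. \<zeta> ^ n \<noteq> 1 \<Longrightarrow> \<delta> \<le> norm (1 - \<zeta> ^ n)"
proof -
  \<comment> \<open>Inserting \<open>1\<close> keeps the set nonempty when \<open>\<zeta> = 1\<close>.\<close>
  define A where "A = insert 1 ((\<lambda>n. norm (1 - \<zeta> ^ n)) ` {n. n < m \<and> \<zeta> ^ n \<noteq> 1})"
  have fin: "finite A" by (simp add: A_def)
  have "0 < Min A"
    using fin by (subst Min_gr_iff) (auto simp: A_def)
  moreover have "Min A \<le> norm (1 - \<zeta> ^ n)" if "\<zeta> ^ n \<noteq> 1" for n
  proof -
    have "\<zeta> ^ n = \<zeta> ^ (n mod m + m * (n div m))" by simp
    also have "\<dots> = \<zeta> ^ (n mod m)" by (simp only: power_add power_mult assms power_one mult_1_right)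
    finally have "norm (1 - \<zeta> ^ n) \<in> A"
      using that assms(1) by (auto simp: A_def)
    then show ?thesis using fin by simp
  qed
  ultimately show ?thesis using that by blast
qed

text \<open>
  Expanding the logarithms and exchanging the finite product with the series gives
  \[ \log \prod_{k=1}^N \frac{1 - q^k}{1 - w q^k}
     = - \sum_{n \ge 1} \frac{1 - w^n}{n} \sum_{k=1}^N q^{nk}. \]
  If \<open>\<zeta> ^ n = 1\<close>, the inner sum is a nonnegative real and the term has real part at most \<open>0\<close>;
  among these only \<open>n = m\<close> is kept. If \<open>\<zeta> ^ n \<noteq> 1\<close>, the inner sum is geometric with ratio
  bounded away from \<open>1\<close>, and the term is at most a constant times \<open>\<rho> ^ n / n\<close>. These errors
  add up to a multiple of \<open>- ln (1 - \<rho>)\<close>. The factor \<open>8 / \<delta>\<close> collects the bounds \<open>2\<close> for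
  \<open>norm (1 - w ^ n)\<close>, \<open>2\<close> for the numerator of the geometric sum and \<open>2 / \<delta>\<close> for the
  reciprocal of its denominator.
\<close>

lemma norm_q_poch_quotient_le:
  assumes "norm w \<le> 1" "0 < m" "\<zeta> ^ m = 1" "0 < \<rho>" "\<rho> < 1"
    and "0 < \<delta>" and gap: "\<And>n. \<zeta> ^ n \<noteq> 1 \<Longrightarrow> \<delta> \<le> norm (1 - \<zeta> ^ n)"
  defines "q \<equiv> of_real \<rho> * \<zeta>"
  shows "norm (q_poch 1 q N / q_poch w q N) \<le>
    exp (- (1 - Re (w ^ m)) / m * (\<Sum>k=1..N. (\<rho> ^ m) ^ k) - 8 / \<delta> * ln (1 - \<rho>))"
proof -
  have norm_\<zeta>: "norm \<zeta> = 1"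
    using assms(2,3) power_eq_1_iff by blast
  have norm_q: "norm q = \<rho>"
    using assms(4) by (simp add: q_def norm_mult norm_\<zeta>)
  have log_series: "(\<lambda>n. - (z ^ n) / of_nat n) sums ln (1 - z)" if "norm z < 1" for z :: complex
    using Ln_series'[of "- z"] that by simp
  \<comment> \<open>The logarithmic series here start at \<open>n = 0\<close>, where division by zero makes the terms vanish.\<close>
  define a where "a n = - (1 - w ^ n) / of_nat n * (\<Sum>k=1..N. (q ^ n) ^ k)" for n
  define lg where "lg = (\<Sum>k=1..N. ln (1 - 1 * q ^ k) - ln (1 - w * q ^ k))"
  have "(\<lambda>n. \<Sum>k=1..N. - ((1 * q ^ k) ^ n) / of_nat n - - ((w * q ^ k) ^ n) / of_nat n) sums lg"
    unfolding lg_def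
    by (intro sums_sum sums_diff log_series norm_mult_power_less_one) (use assms norm_q in auto)
  also have "(\<lambda>n. \<Sum>k=1..N. - ((1 * q ^ k) ^ n) / of_nat n - - ((w * q ^ k) ^ n) / of_nat n) = a"
  proof
    fix n
    have "- ((1 * q ^ k) ^ n) / of_nat n - - ((w * q ^ k) ^ n) / of_nat n
        = - (1 - w ^ n) / of_nat n * (q ^ n) ^ k" for k
      by (simp add: power_mult_distrib flip: power_mult)
         (simp add: mult.commute algebra_simps flip: diff_divide_distrib add_divide_distrib)
    then show "(\<Sum>k=1..N. - ((1 * q ^ k) ^ n) / of_nat n - - ((w * q ^ k) ^ n) / of_nat n) = a n"
      by (simp only: a_def sum_distrib_left)
  qed
  finally have sums_a: "(\<lambda>n. Re (a n)) sums Re lg"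
    by (rule sums_Re)
  define s where "s n = (\<Sum>k=1..N. (\<rho> ^ n) ^ k)" for n
  have s_nonneg: "0 \<le> s n" for n
    using assms(4) by (auto simp: s_def intro!: sum_nonneg)
  \<comment> \<open>The majorant of \<open>Re (a n)\<close>, written as the retained term plus a multiple of a log series.\<close>
  define b where "b n = (if n = m then - (1 - Re (w ^ m)) / m * s m else 0) + - (8 / \<delta>) * (- (\<rho> ^ n) / n)" for n
  have "(\<lambda>n. - (\<rho> ^ n) / real n) sums ln (1 - \<rho>)"
    using ln_series'[of "- \<rho>"] assms(4,5) by simp
  then have sums_b: "b sums (- (1 - Re (w ^ m)) / m * s m + - (8 / \<delta>) * ln (1 - \<rho>))"
    unfolding b_def by (intro sums_add sums_mult sums_single)
  have "Re (a n) \<le> b n" for n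
  proof (cases "\<zeta> ^ n = 1")
    case True
    have "q ^ n = of_real (\<rho> ^ n)"
      by (simp add: q_def power_mult_distrib True)
    then have "a n = (s n / n) *\<^sub>R - (1 - w ^ n)"
      by (simp add: a_def s_def scaleR_conv_of_real)
    then have Re_a: "Re (a n) = - (1 - Re (w ^ n)) / n * s n"
      by (simp add: mult.commute)
    have "Re (w ^ n) \<le> 1"
      using assms(1) complex_Re_le_cmod[of "w ^ n"] power_le_one[of "norm w" n] by (simp add: norm_power)
    then have "- (1 - Re (w ^ n)) / n * s n \<le> 0"
      using s_nonneg by (intro mult_nonpos_nonneg) (auto simp: divide_nonpos_nonneg)
    moreover have "0 \<le> - (8 / \<delta>) * (- (\<rho> ^ n) / n)"
      using assms(4,6) by simp
    ultimately show ?thesis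
      using Re_a by (cases "n = m") (simp_all add: b_def)
  next
    case False
    then have "n \<noteq> m" using assms(3) by auto
    have "norm (q ^ n) < 1"
      using False assms(4,5) norm_q by (cases "n = 0") (auto simp: norm_power power_less_one_iff)
    then have "q ^ n \<noteq> 1" by auto
    have "\<delta> / 2 \<le> norm (1 - \<zeta> ^ n) / 2"
      using gap[OF False] by simp
    also have "\<dots> \<le> norm (1 - of_real (\<rho> ^ n) * \<zeta> ^ n)"
      using assms(4,5) by (intro norm_one_minus_scaled_ge) (auto simp: norm_power norm_\<zeta> power_le_one)
    finally have den: "\<delta> / 2 \<le> norm (1 - q ^ n)"
      by (simp add: q_def power_mult_distrib)
    have "(\<Sum>k=1..N. (q ^ n) ^ k) = q ^ n * (1 - (q ^ n) ^ N) / (1 - q ^ n)"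
      using \<open>q ^ n \<noteq> 1\<close>
      by (simp add: sum.atLeast1_atMost_eq sum_gp_strict flip: sum_distrib_left)
    also have "norm \<dots> \<le> \<rho> ^ n * 2 / (\<delta> / 2)"
    proof -
      have "norm (1 - (q ^ n) ^ N) \<le> 1 + norm ((q ^ n) ^ N)"
        using norm_triangle_ineq4[of 1 "(q ^ n) ^ N"] by simp
      also have "\<dots> \<le> 2"
        using \<open>norm (q ^ n) < 1\<close> by (simp add: norm_power power_le_one)
      finally show ?thesis
        unfolding norm_divide norm_mult using den assms(4,6)
        by (intro frac_le mult_mono) (auto simp: norm_power norm_q)
    qed
    finally have geo: "norm (\<Sum>k=1..N. (q ^ n) ^ k) \<le> 4 * \<rho> ^ n / \<delta>"
      by simp
    have "norm (1 - w ^ n) \<le> 2"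
      using norm_triangle_ineq4[of 1 "w ^ n"] assms(1) power_le_one[of "norm w" n]
      by (simp add: norm_power)
    then have "norm (a n) \<le> 2 / n * (4 * \<rho> ^ n / \<delta>)"
      unfolding a_def norm_mult norm_divide norm_minus_cancel
      using geo by (intro mult_mono) (auto intro: divide_right_mono)
    then show ?thesis
      using complex_Re_le_cmod[of "a n"] \<open>n \<noteq> m\<close> by (simp add: b_def mult_ac)
  qed
  then have "Re lg \<le> - (1 - Re (w ^ m)) / m * s m + - (8 / \<delta>) * ln (1 - \<rho>)"
    using sums_le[OF _ sums_a sums_b] by blast
  moreover have "q_poch 1 q N / q_poch w q N = exp lg"
  proof -
    have "exp lg = (\<Prod>k=1..N. (1 - 1 * q ^ k) / (1 - w * q ^ k))"
      unfolding lg_def using assms(1,5) norm_q q_poch_factor_nonzero[of 1 q] q_poch_factor_nonzero[of w q]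
      by (subst exp_sum) (auto simp: exp_diff intro!: prod.cong)
    then show ?thesis
      by (simp only: q_poch_def prod_dividef)
  qed
  ultimately show ?thesis
    by (simp add: norm_exp_eq_Re s_def)
qed

lemma exp_reciprocal_beats_log:
  fixes a b K :: real
  assumes "0 < a"
  shows "((\<lambda>\<rho>. exp (b - a / (1 - \<rho>) - K * ln (1 - \<rho>))) \<longlongrightarrow> 0) (at_left 1)"
  using assms by real_asymp

text \<open>
  As \<open>w ^ m \<noteq> 1\<close> lies in the closed unit disk, \<open>1 - Re (w ^ m)\<close> is positive, so in the
  estimate above the retained term is of order \<open>- 1 / (1 - \<rho>)\<close> as \<open>\<rho>\<close> increases to
  \<open>1\<close>, whereas the error is only logarithmic.
\<close>

lemma q_poch_ratio_radially_tendsto_0: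
  assumes "norm w \<le> 1" "w ^ m \<noteq> 1" "0 < m" "\<zeta> ^ m = 1"
  shows "(q_poch_ratio w \<longlongrightarrow> 0) (radially \<zeta>)"
proof -
  obtain \<delta> where \<delta>: "0 < \<delta>" "\<And>n. \<zeta> ^ n \<noteq> 1 \<Longrightarrow> \<delta> \<le> norm (1 - \<zeta> ^ n)"
    using root_of_unity_powers_gap[OF assms(3,4)] by metis
  define c where "c = (1 - Re (w ^ m)) / m"
  have "norm (w ^ m) \<le> 1"
    using assms(1) by (simp add: norm_power power_le_one)
  then have "Re (w ^ m) \<noteq> 1"
    using assms(2) by (auto simp: complex_eq_iff cmod_def)
  then have "0 < c"
    using complex_Re_le_cmod[of "w ^ m"] \<open>norm (w ^ m) \<le> 1\<close> assms(3) by (simp add: c_def)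
  have bound: "norm (q_poch_ratio w (of_real \<rho> * \<zeta>)) \<le> exp (c - (c / m) / (1 - \<rho>) - 8 / \<delta> * ln (1 - \<rho>))"
    if \<rho>: "0 < \<rho>" "\<rho> < 1" for \<rho> :: real
  proof -
    have "norm \<zeta> = 1" using assms(3,4) power_eq_1_iff by blast
    then have q: "norm (of_real \<rho> * \<zeta>) < 1" using \<rho> by (simp add: norm_mult)
    have "\<rho> ^ m < 1" using \<rho> assms(3) by (simp add: power_less_one_iff)
    then have "(\<lambda>k. \<rho> ^ m * (\<rho> ^ m) ^ k) sums (\<rho> ^ m * (1 / (1 - \<rho> ^ m)))"
      using \<rho> by (intro sums_mult geometric_sums) auto
    then have geo: "(\<lambda>N. \<Sum>k=1..N. (\<rho> ^ m) ^ k) \<longlonglongrightarrow> \<rho> ^ m * (1 / (1 - \<rho> ^ m))"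
      by (simp add: sums_def sum.atLeast1_atMost_eq)
    have "norm (q_poch_ratio w (of_real \<rho> * \<zeta>)) \<le>
        exp (- c * (\<rho> ^ m * (1 / (1 - \<rho> ^ m))) - 8 / \<delta> * ln (1 - \<rho>))"
    proof (rule LIMSEQ_le)
      show "(\<lambda>N. norm (q_poch 1 (of_real \<rho> * \<zeta>) N / q_poch w (of_real \<rho> * \<zeta>) N)) \<longlonglongrightarrow>
          norm (q_poch_ratio w (of_real \<rho> * \<zeta>))"
        by (intro tendsto_norm q_poch_ratio_tendsto assms q)
      show "(\<lambda>N. exp (- c * (\<Sum>k=1..N. (\<rho> ^ m) ^ k) - 8 / \<delta> * ln (1 - \<rho>))) \<longlonglongrightarrow>
          exp (- c * (\<rho> ^ m * (1 / (1 - \<rho> ^ m))) - 8 / \<delta> * ln (1 - \<rho>))"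
        by (intro tendsto_intros geo)
      show "\<exists>M. \<forall>N\<ge>M. norm (q_poch 1 (of_real \<rho> * \<zeta>) N / q_poch w (of_real \<rho> * \<zeta>) N) \<le>
          exp (- c * (\<Sum>k=1..N. (\<rho> ^ m) ^ k) - 8 / \<delta> * ln (1 - \<rho>))"
        using norm_q_poch_quotient_le[OF assms(1,3,4) \<rho> \<delta>] unfolding c_def minus_divide_left by blast
    qed
    also have "\<dots> \<le> exp (c - (c / m) / (1 - \<rho>) - 8 / \<delta> * ln (1 - \<rho>))"
    proof -
      \<comment> \<open>Bernoulli's inequality turns the pole of the geometric sum into one in \<open>1 - \<rho>\<close>.\<close>
      have "1 - \<rho> ^ m \<le> m * (1 - \<rho>)"
        using Bernoulli_inequality[of "\<rho> - 1" m] \<rho> by (simp add: algebra_simps)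
      then have "1 / (m * (1 - \<rho>)) \<le> 1 / (1 - \<rho> ^ m)"
        using \<open>\<rho> ^ m < 1\<close> by (intro divide_left_mono) (auto simp: \<rho> assms(3))
      also have "\<dots> = \<rho> ^ m * (1 / (1 - \<rho> ^ m)) + 1"
        using \<open>\<rho> ^ m < 1\<close> by (simp add: field_simps)
      finally have "c * (1 / (m * (1 - \<rho>))) \<le> c * (\<rho> ^ m * (1 / (1 - \<rho> ^ m)) + 1)"
        using \<open>0 < c\<close> by (intro mult_left_mono) auto
      then show ?thesis by (simp add: algebra_simps)
    qed
    finally show ?thesis .
  qed
  have "0 < c / m" using \<open>0 < c\<close> assms(3) by simp
  then have "((\<lambda>\<rho>. exp (c - (c / m) / (1 - \<rho>) - 8 / \<delta> * ln (1 - \<rho>))) \<longlongrightarrow> 0) (at_left 1)"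
    by (rule exp_reciprocal_beats_log)
  moreover have "\<forall>\<^sub>F \<rho> in at_left 1. norm (q_poch_ratio w (of_real \<rho> * \<zeta>)) \<le>
      exp (c - (c / m) / (1 - \<rho>) - 8 / \<delta> * ln (1 - \<rho>))"
    using eventually_at_left_real[OF zero_less_one] by eventually_elim (use bound in auto)
  ultimately have "((\<lambda>\<rho>. q_poch_ratio w (of_real \<rho> * \<zeta>)) \<longlongrightarrow> 0) (at_left 1)"
    by (rule Lim_null_comparison[rotated])
  then show ?thesis
    by (simp add: radially_def filterlim_filtermap)
qed

section \<open>The radial limit\<close>

theorem theorem1p3:
  fixes r t m :: nat and \<zeta> :: complex
  assumes "r < t"
    and "0 < m"
    and "coprime m t"
    and "primitive_root_of_unity m \<zeta>"
  shows "(F (residue_class r t) \<longlongrightarrow> 1 / of_nat t) (radially \<zeta>)"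
proof -
  have "0 < t" using assms(1) by simp
  have "\<zeta> ^ m = 1"
    using assms(4) by (simp add: primitive_root_of_unity_def)
  then have "norm \<zeta> = 1"
    using assms(2) power_eq_1_iff by blast
  have "\<forall>\<^sub>F \<rho> in at_left 1. norm (of_real \<rho> * \<zeta>) < 1"
    using eventually_at_left_real[OF zero_less_one]
    by eventually_elim (simp add: norm_mult \<open>norm \<zeta> = 1\<close>)
  then have disk: "\<forall>\<^sub>F q in radially \<zeta>. norm q < 1"
    by (simp add: radially_def eventually_filtermap)
  have ratio: "(q_poch_ratio (unity_root t j) \<longlongrightarrow> of_bool (j = 0)) (radially \<zeta>)" if "j < t" for j
  proof (cases "j = 0")
    case True
    have "\<forall>\<^sub>F q in radially \<zeta>. q_poch_ratio (unity_root t j) q = 1"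
      using disk by eventually_elim (simp add: True unity_root_def q_poch_ratio_one)
    then show ?thesis
      using True by (simp add: tendsto_eventually)
  next
    case False
    \<comment> \<open>Coprimality keeps the \<open>m\<close>-th power of a nontrivial \<open>t\<close>-th root of unity nontrivial.\<close>
    have "\<not> t dvd m * j"
      using assms(3) False that by (auto simp: coprime_commute coprime_dvd_mult_right_iff dest: dvd_imp_le)
    then have "unity_root t j ^ m \<noteq> 1"
      using \<open>0 < t\<close> by (simp add: unity_root_power unity_root_eq_1_iff)
    then show ?thesis
      using q_poch_ratio_radially_tendsto_0[OF _ _ assms(2) \<open>\<zeta> ^ m = 1\<close>] False by simp
  qed
  have "(q_poch_ratio 0 \<longlongrightarrow> 0) (radially \<zeta>)"
    using assms(2) \<open>\<zeta> ^ m = 1\<close> by (intro q_poch_ratio_radially_tendsto_0) (auto simp: zero_power)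
  then have "((\<lambda>q. (\<Sum>j<t. (q_poch_ratio (unity_root t j) q - q_poch_ratio 0 q) / unity_root t j ^ r) / of_nat t)
      \<longlongrightarrow> (\<Sum>j<t. (of_bool (j = 0) - 0) / unity_root t j ^ r) / of_nat t) (radially \<zeta>)"
    using \<open>0 < t\<close> ratio by (intro tendsto_intros) (auto simp: unity_root_def)
  also have "(\<Sum>j<t. (of_bool (j = 0) - 0) / unity_root t j ^ r) = (\<Sum>j<t. if j = 0 then 1 else 0)"
    by (intro sum.cong) (auto simp: unity_root_def)
  also have "\<dots> = 1" using \<open>0 < t\<close> by simp
  finally have lim: "((\<lambda>q. (\<Sum>j<t. (q_poch_ratio (unity_root t j) q - q_poch_ratio 0 q)
      / unity_root t j ^ r) / of_nat t) \<longlongrightarrow> 1 / of_nat t) (radially \<zeta>)" .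
  have "\<forall>\<^sub>F q in radially \<zeta>. (\<Sum>j<t. (q_poch_ratio (unity_root t j) q - q_poch_ratio 0 q)
      / unity_root t j ^ r) / of_nat t = F (residue_class r t) q"
    using disk by eventually_elim (simp add: F_residue_class_eq \<open>0 < t\<close>)
  then show ?thesis
    by (rule Lim_transform_eventually[OF lim])
qed

end
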